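(* Let $G$ be a graph and $B$ a PSD forcing set of $G$. Let $\mathcal F$ be a relaxed chronology of PSD forces for $B$ on $G$, and let $\mathcal Q$ be the path bundle of $\mathcal F$ induced by a vertex $x\in V(G)$. Then $\operatorname{Term}(\mathcal F|_{\mathcal Q})$ is a PSD forcing set of $G$. Furthermore, a relaxed chronology of PSD forces for $\operatorname{Term}(\mathcal F|_{\mathcal Q})$ on $G$ can be constructed by reversing the forces between vertices in $\mathcal Q$ and preserving all remaining forces; that is, there is a relaxed chronology of PSD forces for $\operatorname{Term}(\mathcal F|_{\mathcal Q})$ whose underlying set of forces consists of the reversals $v\to u$ of all forces $u\to v$ in $\mathcal F|_{\mathcal Q}$ together with all forces of $\mathcal F$ not in $\mathcal F|_{\mathcal Q}$.
   Context: All graphs are finite, simple and undirected. Each vertex is blue or white. PSD rule: if $B$ is the current set of blue vertices, $C$ is a component of $G-B$, and $u\in B$ satisfies $N_G(u)\cap V(C)=\{v\}$, then $u$ can force $v$ to become blue ($u\to v$). $B$ is a PSD forcing set if, starting with exactly $B$ blue, repeated forcing turns all vertices blue. $S_+(G,B)$ is the set of PSD forces $v\to u$ valid when exactly $B$ is blue. Relaxed chronology of PSD forces for a PSD forcing set $B$ on $G$: an ordered family $\mathcal F=\{F^{(k)}\}_{k=1}^K$ of sets of forces ($F^{(k)}=\emptyset$ allowed) such that, with $E_{\mathcal F}^{[0]}=E_{\mathcal F}^{(0)}=B$, $E_{\mathcal F}^{(k)}=\{u: v\to u\in F^{(k)}\text{ for some }v\}$, $E_{\mathcal F}^{[k]}=\bigcup_{j=0}^kE_{\mathcal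 F}^{(j)}$: (1) $F^{(k)}\subseteq S_+(G,E_{\mathcal F}^{[k-1]})$ for all $k$; (2) $v_1\to u,v_2\to u\in F^{(k)}$ implies $v_1=v_2$; (3) $E_{\mathcal F}^{[K]}=V(G)$. Its underlying set of forces is $\bigcup_kF^{(k)}$. For $x\in V(G)$, $\operatorname{rd}(x)$ is the unique $k$ with $x\in E_{\mathcal F}^{(k)}$. Path bundle of $\mathcal F$ induced by $x$: for $0\le k\le\operatorname{rd}(x)-1$ let $C_x^k$ be the component of $G-E_{\mathcal F}^{[k]}$ containing $x$. Let $B=\{v_i^0\}_{i=1}^{|B|}$ and let $Q_i^{[0]}$ be the one-vertex path on $v_i^0$. For each $i$, if $v_i^k\to w\in F^{(k+1)}$ for some $w\in V(C_x^k)$, put $v_i^{k+1}=w$ and obtain $Q_i^{[k+1]}$ by appending $w$ to the end of $Q_i^{[k]}$; otherwise put $v_i^{k+1}=v_i^k$ and $Q_i^{[k+1]}=Q_i^{[k]}$. The induced path bundle is $\mathcal Q=\{Q_i^{[\operatorname{rd}(x)]}\}_{i=1}^{|B|}$. Let $H$ be the subgraph of $G$ induced by the union of the vertex sets of the paths in $\mathcal Q$. $\mathcal F|_{\mathcal Q}=\mathcal F|_H$ is the family $\{F^{(k)}|_H\}_{k=1}^K$, where $F^{(k)}|_H=\{v\to u\in F^{(k)}:u,v\in V(H)\}$. $\operatorname{Term}(\mathcal F|_{\mathcal Q})$ is the set of vertices of $H$ that perform no force in $\mathcal F|_{\mathcal Q}$. *)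

theory Defs
  imports "Graph_Theory.Digraph_Component"
begin

text \<open>
  A finite simple undirected graph is a \<^verbatim>\<open>graph\<close> in the sense of the Graph_Theory
  library: a finite symmetric digraph without loops and multiple arcs. As the arcs are
  symmetric, the components of such a graph (and of its induced subgraphs) are exactly its
  strongly connected components.
\<close>

definition neighbours :: "('a, 'b) pre_digraph \<Rightarrow> 'a \<Rightarrow> 'a set" where
  "neighbours G u = {v. u \<rightarrow>\<^bsub>G\<^esub> v}"

definition delete_verts :: "('a, 'b) pre_digraph \<Rightarrow> 'a set \<Rightarrow> ('a, 'b) pre_digraph" where
  "delete_verts G B = G \<restriction> (verts G - B)"

text \<open>The pair \<^verbatim>\<open>(v, u)\<close> stands for the force \<^verbatim>\<open>v \<rightarrow> u\<close>.\<close>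

type_synonym 'a force = "'a \<times> 'a"

definition psd_forces :: "('a, 'b) pre_digraph \<Rightarrow> 'a set \<Rightarrow> 'a force set" where
  "psd_forces G B =
     {(v, u). v \<in> B \<and>
        (\<exists>C \<in> pre_digraph.sccs_verts (delete_verts G B). neighbours G v \<inter> C = {u})}"

inductive psd_step :: "('a, 'b) pre_digraph \<Rightarrow> 'a set \<Rightarrow> 'a set \<Rightarrow> bool" for G where
  "(v, u) \<in> psd_forces G B \<Longrightarrow> psd_step G B (insert u B)"

definition psd_forcing_set :: "('a, 'b) pre_digraph \<Rightarrow> 'a set \<Rightarrow> bool" where
  "psd_forcing_set G B \<longleftrightarrow> B \<subseteq> verts G \<and> (psd_step G)\<^sup>*\<^sup>* B (verts G)"

text \<open>
  A family of sets of forces \<^verbatim>\<open>F\<^sup>(\<^sup>1\<^sup>), \<dots>, F\<^sup>(\<^sup>K\<^sup>)\<close> is given by \<^verbatim>\<open>K\<close> and a function \<^verbatim>\<open>F\<close> on the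
  natural numbers, of which only the values at \<^verbatim>\<open>1, \<dots>, K\<close> matter. \<^verbatim>\<open>coloured_at B F k\<close> and
  \<^verbatim>\<open>coloured_upto B F k\<close> are the sets of vertices that turn blue in round \<^verbatim>\<open>k\<close> and up to
  round \<^verbatim>\<open>k\<close>, respectively.
\<close>

definition coloured_at :: "'a set \<Rightarrow> (nat \<Rightarrow> 'a force set) \<Rightarrow> nat \<Rightarrow> 'a set" where
  "coloured_at B F k = (if k = 0 then B else {u. \<exists>v. (v, u) \<in> F k})"

definition coloured_upto :: "'a set \<Rightarrow> (nat \<Rightarrow> 'a force set) \<Rightarrow> nat \<Rightarrow> 'a set" where
  "coloured_upto B F k = (\<Union>j\<in>{0..k}. coloured_at B F j)"

definition relaxed_chronology ::
    "('a, 'b) pre_digraph \<Rightarrow> 'a set \<Rightarrow> nat \<Rightarrow> (nat \<Rightarrow> 'a force set) \<Rightarrow> bool" where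
  "relaxed_chronology G B K F \<longleftrightarrow>
     (\<forall>k\<in>{1..K}. F k \<subseteq> psd_forces G (coloured_upto B F (k - 1))) \<and>
     (\<forall>k\<in>{1..K}. \<forall>v1 v2 u. (v1, u) \<in> F k \<and> (v2, u) \<in> F k \<longrightarrow> v1 = v2) \<and>
     coloured_upto B F K = verts G"

definition underlying_forces :: "nat \<Rightarrow> (nat \<Rightarrow> 'a force set) \<Rightarrow> 'a force set" where
  "underlying_forces K F = (\<Union>k\<in>{1..K}. F k)"

definition rd :: "'a set \<Rightarrow> nat \<Rightarrow> (nat \<Rightarrow> 'a force set) \<Rightarrow> 'a \<Rightarrow> nat" where
  "rd B K F x = (THE k. k \<le> K \<and> x \<in> coloured_at B F k)"

definition white_component ::
    "('a, 'b) pre_digraph \<Rightarrow> 'a set \<Rightarrow> (nat \<Rightarrow> 'a force set) \<Rightarrow> 'a \<Rightarrow> nat \<Rightarrow> 'a set" where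
  "white_component G B F x k = pre_digraph.scc_of (delete_verts G (coloured_upto B F k)) x"

text \<open>
  Paths are lists of vertices. \<^verbatim>\<open>bundle_path G B F x b k\<close> is the path that starts at
  \<^verbatim>\<open>b \<in> B\<close>, after \<^verbatim>\<open>k\<close> rounds; its last vertex is the current active vertex. The
  description \<^verbatim>\<open>THE w\<close> is proper for a relaxed chronology, since a valid force of a fixed
  vertex into a fixed component has a unique target.
\<close>

primrec bundle_path ::
    "('a, 'b) pre_digraph \<Rightarrow> 'a set \<Rightarrow> (nat \<Rightarrow> 'a force set) \<Rightarrow> 'a \<Rightarrow> 'a \<Rightarrow> nat \<Rightarrow> 'a list" where
  "bundle_path G B F x b 0 = [b]"
| "bundle_path G B F x b (Suc k) =
     (let p = bundle_path G B F x b k in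
      if \<exists>w \<in> white_component G B F x k. (last p, w) \<in> F (Suc k)
      then p @ [THE w. w \<in> white_component G B F x k \<and> (last p, w) \<in> F (Suc k)]
      else p)"

definition path_bundle ::
    "('a, 'b) pre_digraph \<Rightarrow> 'a set \<Rightarrow> nat \<Rightarrow> (nat \<Rightarrow> 'a force set) \<Rightarrow> 'a \<Rightarrow> 'a list set" where
  "path_bundle G B K F x = (\<lambda>b. bundle_path G B F x b (rd B K F x)) ` B"

definition bundle_graph ::
    "('a, 'b) pre_digraph \<Rightarrow> 'a list set \<Rightarrow> ('a, 'b) pre_digraph" where
  "bundle_graph G Q = G \<restriction> (\<Union>p\<in>Q. set p)"

definition restrict_forces ::
    "(nat \<Rightarrow> 'a force set) \<Rightarrow> ('a, 'b) pre_digraph \<Rightarrow> nat \<Rightarrow> 'a force set" where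
  "restrict_forces F H k = {(v, u). (v, u) \<in> F k \<and> u \<in> verts H \<and> v \<in> verts H}"

definition terminal_verts ::
    "('a, 'b) pre_digraph \<Rightarrow> nat \<Rightarrow> (nat \<Rightarrow> 'a force set) \<Rightarrow> 'a set" where
  "terminal_verts H K F = {v \<in> verts H. \<not> (\<exists>u. (v, u) \<in> underlying_forces K F)}"

end

theory Submission
  imports Defs
begin

text \<open>
  A blue vertex with a neighbour in the white component of x is always the last vertex of one of
  the growing bundle paths. Starting from the ends of the paths, the bundle forces can therefore be
  undone round by round, latest first: when a force u to w of some round is reversed, the
  component of u in the still white part of G is separated from the old white component of x by
  vertices that are blue again, so u is the only neighbour of w in it. Once all bundle vertices,
  and in particular B, are blue, the remaining forces stay valid in their original order, since
  enlarging the blue set only shrinks components.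
\<close>

section \<open>Components after deleting a vertex set, and the forcing rule\<close>

abbreviation component :: "('a, 'b) pre_digraph \<Rightarrow> 'a set \<Rightarrow> 'a \<Rightarrow> 'a set" where
  "component G S u \<equiv> pre_digraph.scc_of (delete_verts G S) u"

lemma verts_delete_verts [simp]: "verts (delete_verts G S) = verts G - S"
  by (simp add: delete_verts_def)

context graph
begin

lemma sym_digraph_delete_verts: "sym_digraph (delete_verts G S)"
  unfolding delete_verts_def by (rule induced_graph_imp_graph[OF induced_induce]) auto

lemma neighbours_sym: "v \<in> neighbours G u \<longleftrightarrow> u \<in> neighbours G v"
  using sym_arcs by (auto simp: neighbours_def intro: arcs_ends_symmetric)

lemma neighbours_verts: "v \<in> neighbours G u \<Longrightarrow> v \<in> verts G \<and> u \<in> verts G"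
  by (auto simp: neighbours_def adj_in_verts)

lemma delete_verts_adj:
  "u \<rightarrow>\<^bsub>delete_verts G S\<^esub> v \<longleftrightarrow> v \<in> neighbours G u \<and> u \<notin> S \<and> v \<notin> S"
proof
  assume "u \<rightarrow>\<^bsub>delete_verts G S\<^esub> v"
  then show "v \<in> neighbours G u \<and> u \<notin> S \<and> v \<notin> S"
    by (auto simp: delete_verts_def neighbours_def arcs_ends_conv)
next
  assume a: "v \<in> neighbours G u \<and> u \<notin> S \<and> v \<notin> S"
  then have "u \<in> verts G - S" "v \<in> verts G - S"
    using neighbours_verts by blast+
  then show "u \<rightarrow>\<^bsub>delete_verts G S\<^esub> v"
    using a by (auto simp: delete_verts_def neighbours_def arcs_ends_conv)
qed

lemma component_iff_reachable: "v \<in> component G S u \<longleftrightarrow> u \<rightarrow>\<^sup>*\<^bsub>delete_verts G S\<^esub> v"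
proof -
  interpret D: sym_digraph "delete_verts G S" by (rule sym_digraph_delete_verts)
  show ?thesis
    by (auto simp: D.scc_of_def intro: D.symmetric_reachable')
qed

lemma component_refl: "u \<in> verts G \<Longrightarrow> u \<notin> S \<Longrightarrow> u \<in> component G S u"
  by (simp add: component_iff_reachable reachable_def)

lemma component_verts:
  assumes "v \<in> component G S u"
  shows "v \<in> verts G" "v \<notin> S"
proof -
  interpret D: sym_digraph "delete_verts G S" by (rule sym_digraph_delete_verts)
  show "v \<in> verts G" "v \<notin> S"
    using assms D.reachable_in_verts(2) by (auto simp: component_iff_reachable)
qed

lemma component_step:
  assumes "v \<in> component G S u" "w \<in> neighbours G v" "w \<notin> S"
  shows "w \<in> component G S u"
proof -
  interpret D: sym_digraph "delete_verts G S" by (rule sym_digraph_delete_verts)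
  show ?thesis
    using assms component_verts(2)[OF assms(1)]
    by (auto simp: component_iff_reachable delete_verts_adj intro: D.reachable_adj_trans)
qed

lemma component_induct [consumes 1, case_names base step]:
  assumes "v \<in> component G S u" and "P u"
    and step: "\<And>y z. y \<in> component G S u \<Longrightarrow> z \<in> neighbours G y \<Longrightarrow> z \<notin> S \<Longrightarrow> P y \<Longrightarrow> P z"
  shows "P v"
proof -
  interpret D: sym_digraph "delete_verts G S" by (rule sym_digraph_delete_verts)
  have "u \<rightarrow>\<^sup>*\<^bsub>delete_verts G S\<^esub> v"
    using assms(1) by (simp add: component_iff_reachable)
  then show ?thesis
  proof (induction rule: D.reachable_induct)
    case base
    then show ?case using assms(2) by simp
  next
    case (step y z)
    then show ?case
      using assms(3)[of y z] by (simp add: component_iff_reachable delete_verts_adj)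
  qed
qed

lemma component_antimono:
  assumes "S \<subseteq> S'" "u \<in> verts G" "u \<notin> S"
  shows "component G S' u \<subseteq> component G S u"
proof
  fix v assume "v \<in> component G S' u"
  then show "v \<in> component G S u"
    by (induction rule: component_induct)
      (use assms in \<open>auto intro: component_refl component_step\<close>)
qed

lemma component_eq:
  assumes "v \<in> component G S u"
  shows "component G S v = component G S u"
proof -
  interpret D: sym_digraph "delete_verts G S" by (rule sym_digraph_delete_verts)
  show ?thesis
    using assms unfolding set_eq_iff component_iff_reachable
    by (meson D.reachable_trans D.symmetric_reachable')
qed

text \<open>A component that meets the neighbours of \<open>v\<close> exactly in \<open>u\<close>
  contains \<open>u\<close>, so it can only be the component of \<open>u\<close>. This removes the
  quantifier over components from later arguments.\<close>

lemma psd_forces_iff: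
  "(v, u) \<in> psd_forces G S \<longleftrightarrow>
     v \<in> S \<and> u \<in> verts G \<and> u \<notin> S \<and> neighbours G v \<inter> component G S u = {u}"
proof -
  interpret D: sym_digraph "delete_verts G S" by (rule sym_digraph_delete_verts)
  have "(\<exists>C \<in> D.sccs_verts. neighbours G v \<inter> C = {u}) \<longleftrightarrow>
      u \<in> verts G \<and> u \<notin> S \<and> neighbours G v \<inter> component G S u = {u}"
  proof
    assume "\<exists>C \<in> D.sccs_verts. neighbours G v \<inter> C = {u}"
    then obtain z where "neighbours G v \<inter> component G S z = {u}"
      by (auto simp: D.sccs_verts_conv_scc_of)
    moreover from this have "u \<in> component G S z" by blast
    ultimately show "u \<in> verts G \<and> u \<notin> S \<and> neighbours G v \<inter> component G S u = {u}"
      using component_eq component_verts by metis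
  qed (auto simp: D.sccs_verts_conv_scc_of)
  then show ?thesis by (auto simp: psd_forces_def)
qed

text \<open>The component of \<open>u\<close> can only shrink when more vertices are blue, and it
  still contains \<open>u\<close>, so \<open>v\<close> gains no second neighbour in it.\<close>

lemma psd_forces_mono:
  assumes "(v, u) \<in> psd_forces G S" "S \<subseteq> S'" "u \<notin> S'"
  shows "(v, u) \<in> psd_forces G S'"
proof -
  have u: "u \<in> verts G" "u \<notin> S" and "neighbours G v \<inter> component G S u = {u}"
    using assms(1) by (auto simp: psd_forces_iff)
  then have "neighbours G v \<inter> component G S' u = {u}"
    using component_antimono[OF assms(2) u] component_refl[OF u(1) assms(3)] by blast
  then show ?thesis using assms by (auto simp: psd_forces_iff)
qed

text \<open>Forces valid at the same time can be performed one by one, since each stays valid by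
  \<open>psd_forces_mono\<close> while its target is white. This turns a round of a chronology into
  single steps.\<close>

lemma psd_steps_forces:
  assumes "finite U" "\<forall>u\<in>U. \<exists>v. (v, u) \<in> psd_forces G S"
  shows "(psd_step G)\<^sup>*\<^sup>* S (S \<union> U)"
  using assms
proof (induction U rule: finite_induct)
  case empty
  then show ?case by simp
next
  case (insert u U)
  then obtain v where "(v, u) \<in> psd_forces G S" by blast
  then have "(v, u) \<in> psd_forces G (S \<union> U)"
    using insert.hyps psd_forces_mono[of v u S "S \<union> U"] by (auto simp: psd_forces_iff)
  then have "psd_step G (S \<union> U) (insert u (S \<union> U))" by (rule psd_step.intros)
  then show ?case using insert by (simp add: rtranclp.rtrancl_into_rtrancl)
qed

end

section \<open>Blue sets of a relaxed chronology\<close>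

lemma coloured_upto_0 [simp]: "coloured_upto B F 0 = B"
  by (simp add: coloured_upto_def coloured_at_def)

lemma coloured_upto_Suc: "coloured_upto B F (Suc k) = coloured_upto B F k \<union> Range (F (Suc k))"
  by (auto simp: coloured_upto_def coloured_at_def atLeast0_atMost_Suc)

lemma coloured_upto_mono: "j \<le> k \<Longrightarrow> coloured_upto B F j \<subseteq> coloured_upto B F k"
  unfolding coloured_upto_def by (rule UN_mono) auto

lemma coloured_at_subset_upto: "coloured_at B F k \<subseteq> coloured_upto B F k"
  by (auto simp: coloured_upto_def)

locale psd_chronology = graph G for G :: "('a, 'b) pre_digraph" +
  fixes B :: "'a set" and K :: nat and F :: "nat \<Rightarrow> 'a force set"
  assumes chronology: "relaxed_chronology G B K F"
begin

abbreviation blue :: "nat \<Rightarrow> 'a set" where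
  "blue \<equiv> coloured_upto B F"

lemma force_valid: "k < K \<Longrightarrow> (v, u) \<in> F (Suc k) \<Longrightarrow> (v, u) \<in> psd_forces G (blue k)"
  using chronology unfolding relaxed_chronology_def by fastforce

lemma forcer_unique:
  "k < K \<Longrightarrow> (v, u) \<in> F (Suc k) \<Longrightarrow> (v', u) \<in> F (Suc k) \<Longrightarrow> v = v'"
  using chronology unfolding relaxed_chronology_def
  by (metis Suc_le_eq atLeastAtMost_iff le_add1 plus_1_eq_Suc)

lemma blue_K: "blue K = verts G"
  using chronology by (simp add: relaxed_chronology_def)

text \<open>After the earlier of two rounds \<open>u\<close> is blue, whereas a valid force only
  hits white vertices.\<close>

lemma force_round_unique:
  assumes "j < K" "k < K" "(v, u) \<in> F (Suc j)" "(v', u) \<in> F (Suc k)"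
  shows "j = k"
proof -
  have False if "j < k" "k < K" "(v, u) \<in> F (Suc j)" "(v', u) \<in> F (Suc k)" for j k v v'
    using that force_valid[of k v' u] coloured_upto_mono[of "Suc j" k B F]
    by (auto simp: psd_forces_iff coloured_upto_Suc)
  then show ?thesis using assms by (meson linorder_neqE_nat)
qed

text \<open>Every round splits into single steps. Applied to the reversed chronology, this shows
  that the terminal set is a forcing set.\<close>

lemma psd_forcing: "psd_forcing_set G B"
proof -
  have "(psd_step G)\<^sup>*\<^sup>* B (blue k)" if "k \<le> K" for k
    using that
  proof (induction k)
    case (Suc k)
    have "finite (Range (F (Suc k)))"
      by (rule finite_subset[OF _ finite_verts])
        (use Suc.prems force_valid[of k] in \<open>auto simp: psd_forces_iff\<close>)
    then have "(psd_step G)\<^sup>*\<^sup>* (blue k) (blue (Suc k))"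
      unfolding coloured_upto_Suc
      by (rule psd_steps_forces) (use Suc.prems force_valid[of k] in auto)
    with Suc show ?case by (meson Suc_leD rtranclp_trans)
  qed simp
  moreover have "B \<subseteq> verts G"
    using coloured_upto_mono[of 0 K B F] blue_K by simp
  ultimately show ?thesis
    using blue_K by (metis order_refl psd_forcing_set_def)
qed

end

section \<open>The bundle induced by \<open>x\<close> and its active vertices\<close>

locale psd_bundle = psd_chronology G B K F
  for G :: "('a, 'b) pre_digraph" and B K F +
  fixes x :: 'a
  assumes x_vert: "x \<in> verts G"
begin

abbreviation m :: nat where
  "m \<equiv> rd B K F x"

abbreviation white_comp :: "nat \<Rightarrow> 'a set" where
  "white_comp \<equiv> white_component G B F x"

abbreviation path :: "'a \<Rightarrow> nat \<Rightarrow> 'a list" where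
  "path \<equiv> bundle_path G B F x"

definition active :: "nat \<Rightarrow> 'a set" where
  "active k = (\<lambda>b. last (path b k)) ` B"

text \<open>Shifted by one: \<^verbatim>\<open>bundle_forces k\<close> are the bundle forces of round \<^verbatim>\<open>k + 1\<close>.\<close>

definition bundle_forces :: "nat \<Rightarrow> 'a force set" where
  "bundle_forces k = {(v, w) \<in> F (Suc k). w \<in> white_comp k}"

text \<open>This justifies the definite description in \<open>rd\<close>: some round colours
  \<open>x\<close> because all vertices are blue in the end, and a second one would force a blue
  vertex.\<close>

lemma rd_props: "m \<le> K \<and> x \<in> coloured_at B F m"
proof -
  have "x \<in> blue K" using x_vert blue_K by simp
  then obtain k where k: "k \<le> K" "x \<in> coloured_at B F k"
    by (auto simp: coloured_upto_def)
  have less: False if ij: "i < j" "j \<le> K" "x \<in> coloured_at B F i" "x \<in> coloured_at B F j" for i j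
  proof -
    obtain l where j: "j = Suc l" "i \<le> l" using \<open>i < j\<close> by (cases j) auto
    then obtain v where "(v, x) \<in> F (Suc l)"
      using ij by (auto simp: coloured_at_def)
    then have "x \<notin> blue l"
      using ij j force_valid[of l v x] by (simp add: psd_forces_iff)
    then show False
      using ij j coloured_upto_mono[of i l B F] coloured_at_subset_upto[of B F i] by blast
  qed
  have "\<exists>!k. k \<le> K \<and> x \<in> coloured_at B F k"
    using k less by (intro ex1I[of _ k]) (auto, meson linorder_neqE_nat)
  then show ?thesis unfolding rd_def by (rule theI')
qed

lemma m_le: "m \<le> K"
  using rd_props by simp

lemma x_white: "k < m \<Longrightarrow> x \<notin> blue k"
proof -
  assume "k < m"
  then obtain l where l: "m = Suc l" "k \<le> l" by (cases m) auto
  then obtain v where "(v, x) \<in> F (Suc l)" using rd_props by (auto simp: coloured_at_def)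
  then have "x \<notin> blue l" using force_valid[of l v x] l m_le by (auto simp: psd_forces_iff)
  then show ?thesis using coloured_upto_mono[OF l(2), of B F] by blast
qed

lemma white_comp_antimono: "Suc k < m \<Longrightarrow> white_comp (Suc k) \<subseteq> white_comp k"
  unfolding white_component_def
  by (rule component_antimono) (auto simp: coloured_upto_Suc x_white x_vert)

lemma white_comp_not_blue: "w \<in> white_comp k \<Longrightarrow> w \<notin> blue k"
  unfolding white_component_def by (rule component_verts)

lemma white_comp_step:
  "v \<in> white_comp k \<Longrightarrow> w \<in> neighbours G v \<Longrightarrow> w \<notin> blue k \<Longrightarrow> w \<in> white_comp k"
  unfolding white_component_def by (rule component_step)

text \<open>The target \<open>w\<close> lies in the white component of \<open>x\<close>, so its own
  component, which the forcing rule speaks of, is that same one.\<close>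

lemma bundle_force_nbs:
  assumes "k < m" "(v, w) \<in> bundle_forces k"
  shows "v \<in> blue k" "neighbours G v \<inter> white_comp k = {w}"
proof -
  have "(v, w) \<in> psd_forces G (blue k)" "w \<in> component G (blue k) x"
    using assms force_valid[of k v w] m_le by (auto simp: bundle_forces_def white_component_def)
  then show "v \<in> blue k" "neighbours G v \<inter> white_comp k = {w}"
    using component_eq by (auto simp: psd_forces_iff white_component_def)
qed

lemma bundle_force_target:
  "k < m \<Longrightarrow> (v, w) \<in> bundle_forces k \<Longrightarrow> (v, w') \<in> bundle_forces k \<Longrightarrow> w = w'"
  using bundle_force_nbs by blast

lemma path_Suc_force:
  assumes "k < m" "(last (path b k), w) \<in> bundle_forces k"
  shows "path b (Suc k) = path b k @ [w]"
proof -
  have "(THE w. w \<in> white_comp k \<and> (last (path b k), w) \<in> F (Suc k)) = w"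
    using assms bundle_force_target by (intro the_equality) (auto simp: bundle_forces_def)
  then show ?thesis using assms by (auto simp: Let_def bundle_forces_def)
qed

lemma path_Suc_idle:
  "last (path b k) \<notin> Domain (bundle_forces k) \<Longrightarrow> path b (Suc k) = path b k"
  by (auto simp: Let_def bundle_forces_def)

lemma path_nonempty: "path b k \<noteq> []"
  by (induction k) (auto simp: Let_def)

lemma active_0: "active 0 = B"
  by (simp add: active_def)

lemma active_force: "k < m \<Longrightarrow> v \<in> active k \<Longrightarrow> (v, w) \<in> bundle_forces k \<Longrightarrow> w \<in> active (Suc k)"
  unfolding active_def by (auto simp: path_Suc_force simp del: bundle_path.simps
      intro!: image_eqI[where f = "\<lambda>b. last (path b (Suc k))"])

lemma active_idle: "v \<in> active k \<Longrightarrow> v \<notin> Domain (bundle_forces k) \<Longrightarrow> v \<in> active (Suc k)"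
  using path_Suc_idle by (force simp: active_def simp del: bundle_path.simps)

lemma active_Suc_cases:
  assumes "k < m" "v \<in> active (Suc k)"
  shows "v \<in> Range (bundle_forces k) \<or> v \<in> active k \<and> v \<notin> Domain (bundle_forces k)"
proof -
  obtain b where b: "b \<in> B" "v = last (path b (Suc k))"
    using assms by (auto simp: active_def simp del: bundle_path.simps)
  show ?thesis
  proof (cases "last (path b k) \<in> Domain (bundle_forces k)")
    case True
    then show ?thesis using path_Suc_force[OF assms(1)] b by fastforce
  next
    case False
    then show ?thesis using path_Suc_idle[OF False] b by (auto simp: active_def)
  qed
qed

text \<open>Induction on the round. If \<open>v\<close> was blue before, it was active and did not
  force, since its only possible target was the neighbour \<open>y\<close> that is still white. If
  \<open>v\<close> has just turned blue, then \<open>y\<close> shows that it lay in the white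
  component of \<open>x\<close>, so it was forced along the bundle by an active vertex.\<close>

lemma blue_nbs_active:
  assumes "k < m" "v \<in> blue k" "neighbours G v \<inter> white_comp k \<noteq> {}"
  shows "v \<in> active k"
  using assms
proof (induction k arbitrary: v)
  case 0
  then show ?case by (simp add: active_0)
next
  case (Suc k)
  have k: "k < m" using Suc.prems by simp
  obtain y where y: "y \<in> neighbours G v" "y \<in> white_comp (Suc k)" "y \<in> white_comp k"
    using Suc.prems(3) white_comp_antimono[OF Suc.prems(1)] by blast
  show ?case
  proof (cases "v \<in> blue k")
    case True
    have "v \<notin> Domain (bundle_forces k)"
    proof
      assume "v \<in> Domain (bundle_forces k)"
      then obtain w where w: "(v, w) \<in> bundle_forces k" by blast
      then have "y = w" using bundle_force_nbs[OF k] y by blast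
      then have "y \<in> blue (Suc k)" using w by (auto simp: bundle_forces_def coloured_upto_Suc)
      then show False using y white_comp_not_blue by blast
    qed
    then show ?thesis using Suc.IH[OF k True] y active_idle by blast
  next
    case False
    then obtain u where u: "(u, v) \<in> F (Suc k)"
      using Suc.prems(2) by (auto simp: coloured_upto_Suc)
    have "v \<in> white_comp k"
      using white_comp_step[OF y(3) _ False] y(1) neighbours_sym by blast
    then have P: "(u, v) \<in> bundle_forces k" using u by (simp add: bundle_forces_def)
    then have "u \<in> active k"
      using Suc.IH[OF k] bundle_force_nbs[OF k P] by blast
    then show ?thesis using active_force[OF k _ P] by blast
  qed
qed

text \<open>Among the forces of a round, \<open>bundle_forces\<close> selects by the target alone;
  that they run along the bundle paths is a consequence of \<open>blue_nbs_active\<close>.\<close>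

lemma bundle_force_active:
  assumes "k < m" "(v, w) \<in> bundle_forces k"
  shows "v \<in> active k" "w \<in> active (Suc k)"
proof -
  show "v \<in> active k"
    using blue_nbs_active[OF assms(1)] bundle_force_nbs[OF assms] by blast
  then show "w \<in> active (Suc k)" by (rule active_force[OF assms(1) _ assms(2)])
qed

lemma active_blue: "k \<le> m \<Longrightarrow> active k \<subseteq> blue k"
proof (induction k)
  case 0
  then show ?case by (simp add: active_0)
next
  case (Suc k)
  then show ?case
    using active_Suc_cases[of k] by (fastforce simp: coloured_upto_Suc bundle_forces_def)
qed

text \<open>Being blue already, \<open>u\<close> is not the target of a later bundle force, and only
  as a target could it become active again.\<close>

lemma forcing_vertex_inactive:
  assumes "k < m" "u \<in> Domain (bundle_forces k)" "Suc k \<le> j" "j \<le> m"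
  shows "u \<notin> active j"
proof -
  have u: "u \<in> blue k" using assms bundle_force_nbs(1) by blast
  have no_target: "u \<notin> Range (bundle_forces i)" if "k \<le> i" for i
    using u coloured_upto_mono[OF that, of B F] white_comp_not_blue
    by (auto simp: bundle_forces_def)
  show ?thesis
    using assms(3,4)
  proof (induction j rule: dec_induct)
    case base
    then show ?case using active_Suc_cases assms no_target by blast
  next
    case (step j)
    then show ?case using active_Suc_cases[of j u] no_target[of j] by auto
  qed
qed

section \<open>Undoing the bundle forces, latest round first\<close>

definition active_from :: "nat \<Rightarrow> 'a set" where
  "active_from k = (\<Union>j\<in>{k..m}. active j)"

lemma active_subset_from: "k \<le> j \<Longrightarrow> j \<le> m \<Longrightarrow> active j \<subseteq> active_from k"
  by (auto simp: active_from_def)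

lemma active_from_m: "active_from m = active m"
  by (simp add: active_from_def)

text \<open>The set \<open>active_from k\<close> is what is blue once rounds \<open>m\<close> down
  to \<open>k + 1\<close> are undone. Idle vertices of \<open>active k\<close> are still in
  \<open>active (Suc k)\<close>, so undoing one more round adds just its forcing vertices.\<close>

lemma active_from_step:
  assumes "k < m"
  shows "active_from k = active_from (Suc k) \<union> Domain (bundle_forces k)"
proof -
  have "active_from k = active k \<union> active_from (Suc k)"
    using assms unfolding active_from_def
    by (subst atLeastAtMost_insertL[symmetric]) auto
  moreover have "active (Suc k) \<subseteq> active_from (Suc k)"
    using assms by (simp add: active_subset_from)
  ultimately show ?thesis
    using active_idle bundle_force_active(1)[OF assms] by blast
qed

text \<open>A round adds to a path at most its new end, so the vertices of the paths are the ends
  that have occurred so far.\<close>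

lemma paths_union: "(\<Union>b\<in>B. set (path b k)) = (\<Union>j\<in>{0..k}. active j)"
proof (induction k)
  case 0
  then show ?case by (simp add: active_0)
next
  case (Suc k)
  have "set (path b (Suc k)) = insert (last (path b (Suc k))) (set (path b k))" for b
    using path_nonempty[of b k] by (auto simp: Let_def)
  then have "(\<Union>b\<in>B. set (path b (Suc k))) = active (Suc k) \<union> (\<Union>b\<in>B. set (path b k))"
    unfolding active_def by blast
  then show ?case by (simp only: Suc.IH atLeast0_atMost_Suc UN_insert)
qed

text \<open>
  A path from a white vertex u into \<^verbatim>\<open>white_comp k\<close> would have to enter it from a vertex that is
  active in round k and has left the active set afterwards. Such a vertex forces in that round, so
  its only neighbour in \<^verbatim>\<open>white_comp k\<close> is the target of its force, which is blue again.
\<close>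

lemma component_misses_white_comp:
  assumes k: "k < m" and u: "u \<in> Domain (bundle_forces k)"
    and y: "y \<in> component G (active_from (Suc k)) u"
  shows "y \<notin> white_comp k"
  using y
proof (induction rule: component_induct)
  case base
  then show ?case using u bundle_force_nbs(1)[OF k] white_comp_not_blue by blast
next
  case (step y z)
  show ?case
  proof
    assume z: "z \<in> white_comp k"
    have nb: "y \<in> neighbours G z" using step neighbours_sym by blast
    then have "y \<in> blue k" using white_comp_step[OF z] step by blast
    then have "y \<in> active k" using blue_nbs_active[OF k] z step by blast
    moreover have "active (Suc k) \<subseteq> active_from (Suc k)"
      using k by (simp add: active_subset_from)
    moreover have "y \<notin> active_from (Suc k)"
      using component_verts(2)[OF step(1)] .
    ultimately obtain w where w: "(y, w) \<in> bundle_forces k"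
      using active_idle by blast
    then have "z = w" using bundle_force_nbs(2)[OF k] z step by blast
    then show False
      using step bundle_force_active(2)[OF k w] \<open>active (Suc k) \<subseteq> _\<close> by blast
  qed
qed

text \<open>A neighbour \<open>y\<close> of \<open>w\<close> in the component of \<open>u\<close> is
  outside \<open>white_comp k\<close>, hence blue and active in round \<open>k\<close>. It is no
  longer active afterwards, so it forces, and its target can only be \<open>w\<close>. As
  \<open>w\<close> has one forcer, \<open>y\<close> is \<open>u\<close>.\<close>

lemma reversed_force_valid:
  assumes k: "k < m" and P: "(u, w) \<in> bundle_forces k"
  shows "(w, u) \<in> psd_forces G (active_from (Suc k))"
proof -
  let ?D = "active_from (Suc k)"
  have sub: "active (Suc k) \<subseteq> ?D" using k by (simp add: active_subset_from)
  have dom: "u \<in> Domain (bundle_forces k)" using P by blast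
  have uw: "w \<in> neighbours G u" "w \<in> white_comp k" "u \<in> verts G"
    using bundle_force_nbs(2)[OF k P] neighbours_verts by blast+
  have "u \<notin> ?D" using forcing_vertex_inactive[OF k dom] by (auto simp: active_from_def)
  moreover have "w \<in> ?D" using bundle_force_active(2)[OF k P] sub by blast
  moreover have "neighbours G w \<inter> component G ?D u = {u}"
  proof (intro equalityI subsetI)
    fix y assume y: "y \<in> neighbours G w \<inter> component G ?D u"
    then have "y \<notin> white_comp k" using component_misses_white_comp[OF k dom] by blast
    then have "y \<in> blue k" using white_comp_step[OF uw(2)] y by blast
    moreover have wy: "w \<in> neighbours G y" using y neighbours_sym by blast
    ultimately have "y \<in> active k" using blue_nbs_active[OF k] uw(2) by blast
    moreover have "y \<notin> ?D" using y component_verts(2) by blast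
    ultimately obtain w' where w': "(y, w') \<in> bundle_forces k"
      using active_idle sub by blast
    then have "w = w'" using bundle_force_nbs(2)[OF k w'] wy uw(2) by blast
    then show "y \<in> {u}"
      using P w' forcer_unique[of k] k m_le by (auto simp: bundle_forces_def)
  next
    fix y assume "y \<in> {u}"
    then show "y \<in> neighbours G w \<inter> component G ?D u"
      using uw \<open>u \<notin> ?D\<close> neighbours_sym component_refl by blast
  qed
  ultimately show ?thesis using uw by (simp add: psd_forces_iff)
qed

section \<open>The vertices of the bundle and the forces between them\<close>

definition bundle_verts :: "'a set" where
  "bundle_verts = (\<Union>b\<in>B. set (path b m))"

lemma bundle_verts_eq: "bundle_verts = active_from 0"
  by (simp add: bundle_verts_def active_from_def paths_union)

text \<open>A forced vertex is not in \<open>B\<close>, so it entered the bundle as the target of a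
  bundle force; since it is coloured in only one round, that is the given force. Hence restricting
  \<open>F\<close> to the bundle leaves exactly the bundle forces.\<close>

lemma bundle_verts_target:
  assumes "k < K" "(v, u) \<in> F (Suc k)" "u \<in> bundle_verts"
  shows "k < m \<and> (v, u) \<in> bundle_forces k"
proof -
  have white: "u \<notin> blue k" using force_valid[OF assms(1,2)] by (simp add: psd_forces_iff)
  have "\<exists>j<m. u \<in> Range (bundle_forces j)" if "j \<le> m" "u \<in> active j" for j
    using that
  proof (induction j)
    case 0
    then show ?case using white coloured_upto_mono[of 0 k B F] by (auto simp: active_0)
  next
    case (Suc j)
    then show ?case using active_Suc_cases[of j u] by (auto dest: Suc_le_lessD)
  qed
  moreover obtain i where "i \<le> m" "u \<in> active i"
    using assms(3) by (auto simp: bundle_verts_eq active_from_def)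
  ultimately obtain j v' where j: "j < m" "(v', u) \<in> bundle_forces j" by blast
  then have v': "(v', u) \<in> F (Suc j)" "j < K" "u \<in> white_comp j"
    using m_le by (simp_all add: bundle_forces_def)
  then have "j = k" using force_round_unique[OF _ assms(1) _ assms(2)] by blast
  then show ?thesis using j(1) v'(3) assms(2) by (simp add: bundle_forces_def)
qed

lemma bundle_forces_verts:
  assumes "k < m" "(v, u) \<in> bundle_forces k"
  shows "v \<in> bundle_verts" "u \<in> bundle_verts"
proof -
  have "active k \<subseteq> bundle_verts" "active (Suc k) \<subseteq> bundle_verts"
    unfolding bundle_verts_eq using assms(1) by (simp_all add: active_subset_from)
  then show "v \<in> bundle_verts" "u \<in> bundle_verts"
    using bundle_force_active[OF assms] by blast+
qed

lemma restrict_forces_bundle: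
  assumes "verts H = bundle_verts" "k < K"
  shows "restrict_forces F H (Suc k) = (if k < m then bundle_forces k else {})"
proof -
  have "(v, u) \<in> restrict_forces F H (Suc k) \<longleftrightarrow> k < m \<and> (v, u) \<in> bundle_forces k" for v u
  proof
    assume "(v, u) \<in> restrict_forces F H (Suc k)"
    then have "(v, u) \<in> F (Suc k)" "u \<in> bundle_verts"
      by (auto simp: restrict_forces_def assms(1))
    then show "k < m \<and> (v, u) \<in> bundle_forces k" by (rule bundle_verts_target[OF assms(2)])
  next
    assume P: "k < m \<and> (v, u) \<in> bundle_forces k"
    then have "(v, u) \<in> F (Suc k)" by (simp add: bundle_forces_def)
    with P show "(v, u) \<in> restrict_forces F H (Suc k)"
      using bundle_forces_verts[of k v u] by (simp add: restrict_forces_def assms(1))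
  qed
  then show ?thesis by auto
qed

lemma underlying_restrict_forces:
  assumes "verts H = bundle_verts"
  shows "underlying_forces K (restrict_forces F H) = (\<Union>k<m. bundle_forces k)"
proof -
  have "underlying_forces K (restrict_forces F H) = (\<Union>k<K. restrict_forces F H (Suc k))"
    unfolding underlying_forces_def image_Suc_lessThan[symmetric] by blast
  also have "\<dots> = (\<Union>k<m. bundle_forces k)"
    using m_le by (fastforce simp: restrict_forces_bundle[OF assms] split: if_splits)
  finally show ?thesis .
qed

text \<open>A vertex stays active until it forces and never returns afterwards, so those that never
  force are the ones active in round \<open>m\<close>.\<close>

lemma terminal_verts_bundle:
  assumes "verts H = bundle_verts"
  shows "terminal_verts H K (restrict_forces F H) = active m"
proof -
  have "v \<in> active m \<or> v \<in> (\<Union>k<m. Domain (bundle_forces k))" if "j \<le> m" "v \<in> active j" for j v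
    using that
  proof (induction j rule: inc_induct)
    case (step j)
    then show ?case using active_idle by blast
  qed simp
  then have "bundle_verts \<subseteq> active m \<union> (\<Union>k<m. Domain (bundle_forces k))"
    unfolding bundle_verts_eq active_from_def by fastforce
  moreover have "active m \<subseteq> bundle_verts"
    by (auto simp: bundle_verts_eq active_from_def)
  moreover have "active m \<inter> (\<Union>k<m. Domain (bundle_forces k)) = {}"
    using forcing_vertex_inactive[of _ _ m] by (auto simp: Suc_le_eq simp del: Domain_iff)
  moreover have "terminal_verts H K (restrict_forces F H)
      = bundle_verts - (\<Union>k<m. Domain (bundle_forces k))"
    by (auto simp: terminal_verts_def underlying_restrict_forces[OF assms] assms)
  moreover have "X - D = A" if "X \<subseteq> A \<union> D" "A \<subseteq> X" "A \<inter> D = {}" for X A D :: "'a set"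
    using that by blast
  ultimately show ?thesis by metis
qed

section \<open>The reversed chronology: \<open>m\<close> rounds of undoing, then \<open>K\<close>
  rounds of replay\<close>

definition reversed_forces :: "('a, 'b) pre_digraph \<Rightarrow> nat \<Rightarrow> 'a force set" where
  "reversed_forces H k = (if k \<le> m then (bundle_forces (m - k))\<inverse>
     else F (k - m) - restrict_forces F H (k - m))"

text \<open>For positive \<open>k\<close>, reversed round \<open>k\<close> undoes
  \<open>bundle_forces (m - k)\<close>, which belongs to the original round \<open>m - k + 1\<close>
  because of the shift.\<close>

lemma coloured_reversed: "k \<le> m \<Longrightarrow> coloured_upto (active m) (reversed_forces H) k = active_from (m - k)"
proof (induction k)
  case 0
  then show ?case by (simp add: active_from_m)
next
  case (Suc k)
  then have "active_from (m - Suc k) = active_from (m - k) \<union> Domain (bundle_forces (m - Suc k))"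
    using active_from_step[of "m - Suc k"] by (simp add: Suc_diff_Suc)
  then show ?case using Suc by (simp add: coloured_upto_Suc reversed_forces_def)
qed

text \<open>The replay starts with the whole bundle blue, including \<open>B\<close>. Leaving out
  the bundle forces loses no vertex, since their targets are in the bundle.\<close>

lemma coloured_remaining:
  assumes H: "verts H = bundle_verts" and "k \<le> K"
  shows "coloured_upto (active m) (reversed_forces H) (m + k) = bundle_verts \<union> blue k"
  using assms(2)
proof (induction k)
  case 0
  have "B \<subseteq> bundle_verts" using active_0 by (auto simp: bundle_verts_eq active_from_def)
  then show ?case using coloured_reversed[of m H] by (auto simp: bundle_verts_eq)
next
  case (Suc k)
  have rev: "reversed_forces H (Suc (m + k)) = F (Suc k) - restrict_forces F H (Suc k)"
    by (simp add: reversed_forces_def Suc_diff_le)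
  have "Range (restrict_forces F H (Suc k)) \<subseteq> bundle_verts"
    using H by (auto simp: restrict_forces_def)
  then have "bundle_verts \<union> Range (reversed_forces H (Suc (m + k))) = bundle_verts \<union> Range (F (Suc k))"
    unfolding rev by blast
  moreover have "coloured_upto (active m) (reversed_forces H) (m + Suc k)
      = bundle_verts \<union> blue k \<union> Range (reversed_forces H (Suc (m + k)))"
    using Suc by (simp add: coloured_upto_Suc)
  ultimately show ?case by (auto simp: coloured_upto_Suc)
qed

lemma chronology_reversed:
  assumes H: "verts H = bundle_verts"
  shows "relaxed_chronology G (active m) (m + K) (reversed_forces H)"
proof -
  let ?E = "coloured_upto (active m) (reversed_forces H)"
  have round: "reversed_forces H k \<subseteq> psd_forces G (?E (k - 1)) \<and>
      ((v1, u) \<in> reversed_forces H k \<and> (v2, u) \<in> reversed_forces H k \<longrightarrow> v1 = v2)"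
    if k: "k \<in> {1..m + K}" for k v1 v2 u
  proof (cases "k \<le> m")
    case True
    define j where "j = m - k"
    have j: "j < m" "reversed_forces H k = (bundle_forces j)\<inverse>" "?E (k - 1) = active_from (Suc j)"
      using k True coloured_reversed[of "k - 1" H] by (auto simp: j_def reversed_forces_def Suc_diff_le)
    \<comment> \<open>Under reversal, uniqueness of the forcer becomes uniqueness of the target of a
      vertex in the white component.\<close>
    then show ?thesis using reversed_force_valid bundle_force_target by auto
  next
    case False
    \<comment> \<open>Round \<open>k\<close> replays the original round \<open>j + 1\<close>, now
      with the bundle blue in addition to \<open>blue j\<close>.\<close>
    define j where "j = k - m - 1"
    have j: "j < K" "k - m = Suc j" "k - 1 = m + j" using k False by (auto simp: j_def)
    then have E: "?E (k - 1) = bundle_verts \<union> blue j"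
      using coloured_remaining[OF H, of j] by simp
    have rev: "reversed_forces H k = F (Suc j) - restrict_forces F H (Suc j)"
      using False j by (simp add: reversed_forces_def)
    have "(v, u) \<in> psd_forces G (bundle_verts \<union> blue j)" if "(v, u) \<in> reversed_forces H k" for v u
    proof (rule psd_forces_mono)
      have vu: "(v, u) \<in> F (Suc j)" "(v, u) \<notin> restrict_forces F H (Suc j)"
        using that by (auto simp: rev)
      then show *: "(v, u) \<in> psd_forces G (blue j)" using force_valid j by blast
      \<comment> \<open>A force into the bundle would be a bundle force and thus have been left
        out.\<close>
      have "u \<notin> bundle_verts"
        using bundle_verts_target[OF j(1) vu(1)] vu(2) restrict_forces_bundle[OF H j(1)]
        by auto
      then show "u \<notin> bundle_verts \<union> blue j" using * by (simp add: psd_forces_iff)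
    qed simp
    then show ?thesis using E rev forcer_unique[OF j(1)] by auto
  qed
  moreover have "bundle_verts \<subseteq> verts G"
  proof -
    have "active j \<subseteq> verts G" if "j \<le> m" for j
      using active_blue[OF that] coloured_upto_mono[of j K B F] that m_le blue_K by simp
    then show ?thesis unfolding bundle_verts_eq active_from_def by (intro UN_least) simp
  qed
  then have "?E (m + K) = verts G"
    using coloured_remaining[OF H, of K] blue_K by auto
  ultimately show ?thesis unfolding relaxed_chronology_def by blast
qed

lemma underlying_reversed:
  assumes H: "verts H = bundle_verts"
  shows "underlying_forces (m + K) (reversed_forces H) =
    (underlying_forces K (restrict_forces F H))\<inverse> \<union>
    (underlying_forces K F - underlying_forces K (restrict_forces F H))"
proof -
  have "{1..m + K} = {1..m} \<union> (+) m ` {1..K}"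
    by (auto simp: image_add_atLeastAtMost)
  then have "underlying_forces (m + K) (reversed_forces H) =
      (\<Union>k\<in>{1..m}. reversed_forces H k) \<union> (\<Union>k\<in>{1..K}. reversed_forces H (m + k))"
    by (simp only: underlying_forces_def UN_Un image_image)
  moreover have "(\<Union>k\<in>{1..m}. reversed_forces H k) = (\<Union>k<m. (bundle_forces k)\<inverse>)"
  proof -
    have "(\<lambda>k. m - k) ` {1..m} = {..<m}"
    proof (intro equalityI subsetI)
      fix j assume "j \<in> {..<m}"
      then show "j \<in> (\<lambda>k. m - k) ` {1..m}" by (intro image_eqI[of _ _ "m - j"]) auto
    qed auto
    then have "(\<Union>k<m. (bundle_forces k)\<inverse>) = (\<Union>k\<in>{1..m}. (bundle_forces (m - k))\<inverse>)"
      by (metis image_image)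
    then show ?thesis by (simp add: reversed_forces_def)
  qed
  moreover have "(\<Union>k\<in>{1..K}. reversed_forces H (m + k)) =
      (\<Union>k\<in>{1..K}. F k - restrict_forces F H k)"
    by (rule SUP_cong) (auto simp: reversed_forces_def)
  \<comment> \<open>The difference may be taken after the union because being restricted away
    depends on the ends of a force, not on its round.\<close>
  moreover have "\<dots> = underlying_forces K F - underlying_forces K (restrict_forces F H)"
    by (auto simp: underlying_forces_def restrict_forces_def)
  ultimately show ?thesis
    unfolding underlying_restrict_forces[OF H] by (simp add: converse_UNION)
qed

end

theorem theorem5p10:
  fixes G :: "('a, 'b) pre_digraph" and B :: "'a set"
    and K :: nat and F :: "nat \<Rightarrow> 'a force set" and x :: 'a
  assumes "graph G"
    and "psd_forcing_set G B"
    and "relaxed_chronology G B K F"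
    and "x \<in> verts G"
    and Q: "Q = path_bundle G B K F x"
    and H: "H = bundle_graph G Q"
    and FQ: "FQ = restrict_forces F H"
    and T: "T = terminal_verts H K FQ"
  shows "psd_forcing_set G T \<and>
    (\<exists>K' F'. relaxed_chronology G T K' F' \<and>
       underlying_forces K' F' =
         {(v, u). (u, v) \<in> underlying_forces K FQ} \<union>
         (underlying_forces K F - underlying_forces K FQ))"
proof -
  interpret graph G by fact
  interpret psd_bundle G B K F x
    by unfold_locales fact+
  have vH: "verts H = bundle_verts"
    by (simp add: H Q bundle_graph_def path_bundle_def bundle_verts_def)
  have T': "T = active m"
    unfolding T FQ by (rule terminal_verts_bundle[OF vH])
  \<comment> \<open>The second claim thus comes first; the first one is \<open>psd_forcing\<close>
    for this chronology.\<close>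
  interpret R: psd_chronology G T "m + K" "reversed_forces H"
    by unfold_locales (simp add: T' chronology_reversed[OF vH])
  have "underlying_forces (m + K) (reversed_forces H) =
      {(v, u). (u, v) \<in> underlying_forces K FQ} \<union>
      (underlying_forces K F - underlying_forces K FQ)"
    unfolding underlying_reversed[OF vH] FQ by auto
  then show ?thesis using R.psd_forcing R.chronology by blast
qed

end
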